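(* Let $K$ be a field of characteristic $0$ and let $n\geq 1$. If $F$ is a nice polynomial automorphism of $K^n$, then its inverse $F^{-1}$ is nice.
   Context: $K$ is a field of characteristic $0$. A polynomial map $F=(F_1,\dots,F_n):K^n\to K^n$ is a map whose components $F_i$ are in the polynomial ring $K[X_1,\dots,X_n]$; it is a polynomial automorphism if it has a polynomial inverse. Given a polynomial map $F$, define for $i=1,\dots,n$ the polynomials $P_0^i=X_i$ and, for $k\geq 1$, $P_k^i(X_1,\dots,X_n)=P_{k-1}^i(F_1,\dots,F_n)-P_{k-1}^i(X_1,\dots,X_n)$ (so $P_1^i=F_i-X_i$). The map $F$ is called nice if there exists an integer $m$ such that $P_m^i=0$ for all $i=1,\dots,n$. *)

theory Defs
  imports Complex_Main "HOL-Library.Poly_Mapping"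
begin

text \<open>
  \<open>('n, 'k) mpoly\<close> is the ring of polynomials over \<open>'k\<close> in the variables \<open>X\<^sub>i\<close>, \<open>i :: 'n\<close>:
  a finitely supported family of coefficients indexed by the exponent vectors
  \<open>'n \<Rightarrow>\<^sub>0 nat\<close>, with the convolution product of \<^theory>\<open>HOL-Library.Poly_Mapping\<close>.
  For \<open>'n :: finite\<close> the number of variables is \<open>CARD('n) \<ge> 1\<close>.
\<close>

type_synonym ('n, 'k) mpoly = "('n \<Rightarrow>\<^sub>0 nat) \<Rightarrow>\<^sub>0 'k"

text \<open>A polynomial map is the tuple of its components, as formal polynomials.\<close>

type_synonym ('n, 'k) poly_map = "'n \<Rightarrow> ('n, 'k) mpoly"

definition Var :: "'n \<Rightarrow> ('n, 'k::comm_ring_1) mpoly" where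
  "Var i = Poly_Mapping.single (Poly_Mapping.single i 1) 1"

definition psubst :: "('n::finite, 'k::comm_ring_1) poly_map \<Rightarrow> ('n, 'k) mpoly \<Rightarrow> ('n, 'k) mpoly" where
  "psubst F p = (\<Sum>m\<in>Poly_Mapping.keys p.
     Poly_Mapping.single 0 (Poly_Mapping.lookup p m) * (\<Prod>i\<in>UNIV. F i ^ Poly_Mapping.lookup m i))"

definition pcomp :: "('n::finite, 'k::comm_ring_1) poly_map \<Rightarrow> ('n, 'k) poly_map \<Rightarrow> ('n, 'k) poly_map" where
  "pcomp F G = (\<lambda>i. psubst G (F i))"

definition is_inverse :: "('n::finite, 'k::comm_ring_1) poly_map \<Rightarrow> ('n, 'k) poly_map \<Rightarrow> bool" where
  "is_inverse F G \<longleftrightarrow> pcomp F G = Var \<and> pcomp G F = Var"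

definition poly_automorphism :: "('n::finite, 'k::comm_ring_1) poly_map \<Rightarrow> bool" where
  "poly_automorphism F \<longleftrightarrow> (\<exists>G. is_inverse F G)"

text \<open>Meaningful for automorphisms only; see \<open>is_inverse_poly_map_inv\<close> below.\<close>

definition poly_map_inv :: "('n::finite, 'k::comm_ring_1) poly_map \<Rightarrow> ('n, 'k) poly_map" where
  "poly_map_inv F = (THE G. is_inverse F G)"

primrec iter_diff :: "('n::finite, 'k::comm_ring_1) poly_map \<Rightarrow> nat \<Rightarrow> ('n, 'k) poly_map" where
  "iter_diff F 0 = Var"
| "iter_diff F (Suc k) = (\<lambda>i. psubst F (iter_diff F k i) - iter_diff F k i)"

definition nice :: "('n::finite, 'k::comm_ring_1) poly_map \<Rightarrow> bool" where
  "nice F \<longleftrightarrow> (\<exists>m. \<forall>i. iter_diff F m i = 0)"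


text \<open>Substitution is the homomorphism of \<open>'k\<close>-algebras sending \<open>Var i\<close> to \<open>F i\<close>.\<close>

lemma psubst_superset:
  assumes "finite A" "Poly_Mapping.keys p \<subseteq> A"
  shows "psubst F p = (\<Sum>m\<in>A.
     Poly_Mapping.single 0 (Poly_Mapping.lookup p m) * (\<Prod>i\<in>UNIV. F i ^ Poly_Mapping.lookup m i))"
  unfolding psubst_def
  by (rule sum.mono_neutral_left) (use assms in \<open>auto simp: in_keys_iff\<close>)

lemma psubst_0 [simp]: "psubst F 0 = 0"
  by (simp add: psubst_def)

lemma psubst_single:
  "psubst F (Poly_Mapping.single m c) =
     Poly_Mapping.single 0 c * (\<Prod>i\<in>UNIV. F i ^ Poly_Mapping.lookup m i)"
  by (subst psubst_superset[of "{m}"]) auto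

lemma psubst_Var [simp]: "psubst F (Var i) = F i"
proof -
  have "(\<Prod>j\<in>UNIV. F j ^ Poly_Mapping.lookup (Poly_Mapping.single i 1) j)
      = (\<Prod>j\<in>UNIV. if j = i then F j else 1)"
    by (rule prod.cong) (auto simp: lookup_single when_def)
  then show ?thesis
    by (simp add: Var_def psubst_single)
qed

lemma psubst_const [simp]: "psubst F (Poly_Mapping.single 0 c) = Poly_Mapping.single 0 c"
  by (simp add: psubst_single)

lemma psubst_1 [simp]: "psubst F 1 = 1"
  using psubst_const[of F 1] by simp

lemma psubst_add: "psubst F (p + q) = psubst F p + psubst F q"
proof -
  let ?A = "Poly_Mapping.keys p \<union> Poly_Mapping.keys q"
  have "Poly_Mapping.keys (p + q) \<subseteq> ?A"
    by (rule keys_add)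
  then show ?thesis
    by (simp add: psubst_superset[of ?A] lookup_add single_add distrib_right sum.distrib)
qed

lemma psubst_sum: "psubst F (\<Sum>x\<in>A. g x) = (\<Sum>x\<in>A. psubst F (g x))"
  by (induction A rule: infinite_finite_induct) (auto simp: psubst_add)

lemma psubst_diff: "psubst F (p - q) = psubst F p - psubst F q"
  using psubst_add[of F "p - q" q] by (simp add: algebra_simps)

lemma mpoly_expand:
  "(\<Sum>m\<in>Poly_Mapping.keys p. Poly_Mapping.single m (Poly_Mapping.lookup p m)) = p"
  by (rule poly_mapping_eqI) (auto simp: lookup_sum lookup_single when_def in_keys_iff)

lemma psubst_mult: "psubst F (p * q) = psubst F p * psubst F q"
proof -
  have single: "psubst F (Poly_Mapping.single m c * Poly_Mapping.single m' c')
      = psubst F (Poly_Mapping.single m c) * psubst F (Poly_Mapping.single m' c')" for m m' c c'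
  proof -
    have "Poly_Mapping.single 0 (c * c')
        = (Poly_Mapping.single 0 c * Poly_Mapping.single 0 c' :: ('a, 'b) mpoly)"
      by (simp add: mult_single)
    moreover have "psubst F (Poly_Mapping.single m c * Poly_Mapping.single m' c')
        = Poly_Mapping.single 0 (c * c') * ((\<Prod>i\<in>UNIV. F i ^ Poly_Mapping.lookup m i)
            * (\<Prod>i\<in>UNIV. F i ^ Poly_Mapping.lookup m' i))"
      by (simp add: mult_single psubst_single lookup_add power_add prod.distrib)
    ultimately show ?thesis
      by (simp only: psubst_single mult_ac)
  qed
  have "p * q = (\<Sum>m\<in>Poly_Mapping.keys p. \<Sum>m'\<in>Poly_Mapping.keys q.
      Poly_Mapping.single m (Poly_Mapping.lookup p m)
        * Poly_Mapping.single m' (Poly_Mapping.lookup q m'))"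
    using sum_product[of "\<lambda>m. Poly_Mapping.single m (Poly_Mapping.lookup p m)"
        "Poly_Mapping.keys p" "\<lambda>m. Poly_Mapping.single m (Poly_Mapping.lookup q m)"
        "Poly_Mapping.keys q"]
    by (simp only: mpoly_expand)
  then have "psubst F (p * q) =
      psubst F (\<Sum>m\<in>Poly_Mapping.keys p. Poly_Mapping.single m (Poly_Mapping.lookup p m))
        * psubst F (\<Sum>m\<in>Poly_Mapping.keys q. Poly_Mapping.single m (Poly_Mapping.lookup q m))"
    by (simp only: psubst_sum single sum_product)
  then show ?thesis
    by (simp only: mpoly_expand)
qed

lemma psubst_power: "psubst F (p ^ k) = psubst F p ^ k"
  by (induction k) (auto simp: psubst_mult)

lemma psubst_prod: "psubst F (\<Prod>x\<in>A. g x) = (\<Prod>x\<in>A. psubst F (g x))"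
  by (induction A rule: infinite_finite_induct) (auto simp: psubst_mult)

lemma psubst_psubst: "psubst G (psubst F p) = psubst (pcomp F G) p"
  unfolding psubst_def[of F] psubst_def[of "pcomp F G"]
  by (simp add: psubst_sum psubst_mult psubst_prod psubst_power pcomp_def)

lemma prod_Var_power:
  "(\<Prod>i\<in>UNIV. Var i ^ Poly_Mapping.lookup m i)
     = (Poly_Mapping.single m 1 :: ('n::finite, 'k::comm_ring_1) mpoly)"
proof -
  have pow: "Var i ^ k = (Poly_Mapping.single (Poly_Mapping.single i k) 1 :: ('n, 'k) mpoly)" for i k
    by (induction k) (auto simp: Var_def mult_single simp flip: single_add)
  have "(\<Prod>i\<in>A. Poly_Mapping.single (f i) 1)
      = (Poly_Mapping.single (\<Sum>i\<in>A. f i) 1 :: ('n, 'k) mpoly)"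
    for A :: "'n set" and f
    by (induction A rule: infinite_finite_induct) (auto simp: mult_single)
  moreover have "(\<Sum>i\<in>UNIV. Poly_Mapping.single i (Poly_Mapping.lookup m i)) = m"
    by (rule poly_mapping_eqI) (simp add: lookup_sum lookup_single when_def)
  ultimately show ?thesis
    by (simp add: pow)
qed

lemma psubst_id [simp]: "psubst Var p = p"
  using mpoly_expand[of p] by (simp add: psubst_def prod_Var_power mult_single)

lemma pcomp_assoc: "pcomp (pcomp F G) H = pcomp F (pcomp G H)"
  by (simp add: pcomp_def psubst_psubst)

lemma pcomp_Var [simp]: "pcomp F Var = F" "pcomp Var F = F"
  by (simp_all add: pcomp_def)

lemma is_inverse_unique:
  assumes "is_inverse F G" "is_inverse F H"
  shows "G = H"
  using assms pcomp_assoc[of G F H] by (simp add: is_inverse_def)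

lemma is_inverse_poly_map_inv:
  assumes "poly_automorphism F"
  shows "is_inverse F (poly_map_inv F)"
proof -
  obtain G where "is_inverse F G"
    using assms by (auto simp: poly_automorphism_def)
  then show ?thesis
    unfolding poly_map_inv_def by (rule theI[of "is_inverse F"]) (blast intro: is_inverse_unique \<open>is_inverse F G\<close>)
qed

end

theory Submission
  imports Defs
begin

text \<open>
  Let \<open>T\<close> and \<open>S\<close> be the linear operators on polynomials given by substitution of \<open>F\<close> and
  of its inverse \<open>G\<close>. The iterated differences of \<open>F\<close> are \<open>(T - 1)^k\<close> applied to the
  variables, and \<open>S T = 1\<close> gives \<open>S - 1 = - S (T - 1)\<close>, hence
  \<open>(S - 1)^k = (-1)^k S^k (T - 1)^k\<close>.
\<close>

lemma psubst_minus: "psubst F (- p) = - psubst F p"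
  using psubst_diff[of F 0 p] by simp

lemma funpow_psubst_diff:
  "(psubst F ^^ k) (p - q) = (psubst F ^^ k) p - (psubst F ^^ k) q"
  by (induction k) (simp_all add: psubst_diff)

lemma funpow_psubst_0: "(psubst F ^^ k) 0 = 0"
  by (induction k) simp_all

text \<open>The operator identity above, applied to \<open>Var i\<close>; the hypothesis says S T =
  1. Keeping the sign inside lets the induction work on the argument of S^k alone.\<close>

lemma iter_diff_left_inverse:
  assumes "pcomp F G = Var"
  shows "iter_diff G k i = (psubst G ^^ k) ((- 1) ^ k * iter_diff F k i)"
proof (induction k)
  case 0
  then show ?case by simp
next
  case (Suc k)
  define x where "x = (- 1) ^ k * iter_diff F k i"
  have "psubst G (psubst F p) = p" for p
    by (simp add: psubst_psubst assms)
  \<comment> \<open>Since x = S (T x), the left side is S (x - T x); reversing this difference gives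
    the extra factor -1.\<close>
  then have "psubst G x - x = psubst G ((- 1) ^ Suc k * iter_diff F (Suc k) i)"
    by (simp add: x_def psubst_mult psubst_power psubst_minus psubst_diff algebra_simps)
  \<comment> \<open>S - 1 commutes with S^k.\<close>
  moreover have "iter_diff G (Suc k) i = (psubst G ^^ k) (psubst G x - x)"
    by (simp add: Suc.IH x_def funpow_psubst_diff funpow_swap1)
  ultimately show ?case
    by (simp add: funpow_swap1)
qed

theorem theorem7:
  fixes F :: "('n::finite, 'k::field_char_0) poly_map"
  assumes "poly_automorphism F"
    and "nice F"
  shows "nice (poly_map_inv F)"
proof -
  have inv: "pcomp F (poly_map_inv F) = Var"
    using is_inverse_poly_map_inv[OF assms(1)] by (simp add: is_inverse_def)
  obtain m where "iter_diff F m i = 0" for i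
    using assms(2) by (auto simp: nice_def)
  \<comment> \<open>The same \<open>m\<close> serves the inverse, because S^m sends 0 to 0.\<close>
  then have "iter_diff (poly_map_inv F) m i = 0" for i
    by (simp add: iter_diff_left_inverse[OF inv] funpow_psubst_0)
  then show ?thesis
    by (auto simp: nice_def)
qed

end
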